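(* Let $f:\mathbb{R}^{n\times p}\to\mathbb{R}$ be locally Lipschitz continuous. Let $\beta>0$ and $r\in\left(0,\frac{\beta}{2\beta+16M_1}\right)$. If $X^*\in\Omega_r$ is a local minimizer of $h$ over $\mathbb{R}^{n\times p}$, then $X^*$ is a local minimizer of the problem $\min\{f(X):X\in\mathbb{R}^{n\times p},\ X^\top X=I_p\}$ (in particular $X^*$ is feasible). Moreover, any local minimizer $X^*$ of $\min\{f(X):X\in\mathbb{R}^{n\times p},\ X^\top X=I_p\}$ is a local minimizer of $h$ over $\mathbb{R}^{n\times p}$.
   Context: $\|\cdot\|_{\mathrm F}$ is the Frobenius norm and $\partial$ denotes the Clarke subdifferential. For $r>0$, $\Omega_r=\{X\in\mathbb{R}^{n\times p}:\|X^\top X-I_p\|_{\mathrm F}\le r\}$. $\mathcal{A}(X)=\frac18X\left(15I_p-10X^\top X+3(X^\top X)^2\right)$ for $X\in\mathbb{R}^{n\times p}$, and for a penalty parameter $\beta>0$, $h(X)=f(\mathcal{A}(X))+\frac{\beta}{4}\|X^\top X-I_p\|_{\mathrm F}^2$. $M_1=\sup\{\|W\|_{\mathrm F}:X\in\Omega_1,\ W\in\partial f(X)\}$. A local minimizer of the constrained problem is a point $X^*$ with $X^{*\top}X^*=I_p$ such that $f(Z)\ge f(X^* )$ for all $Z$ with $Z^\top Z=I_p$ sufficiently close to $X^*$. *)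

theory Defs
  imports "HOL-Analysis.Analysis"
begin

definition locally_lipschitz :: "('a::metric_space \<Rightarrow> 'b::metric_space) \<Rightarrow> bool" where
  "locally_lipschitz f \<longleftrightarrow> (\<forall>x. \<exists>e>0. \<exists>L. L-lipschitz_on (ball x e) f)"

definition local_minimizer_on :: "('a::metric_space \<Rightarrow> real) \<Rightarrow> 'a set \<Rightarrow> 'a \<Rightarrow> bool" where
  "local_minimizer_on f S x \<longleftrightarrow> x \<in> S \<and> (\<exists>e>0. \<forall>z\<in>S. dist z x < e \<longrightarrow> f x \<le> f z)"

text \<open>The generalized directional derivative is the upper limit of \<open>(f (y + t d) - f y) / t\<close>
  as \<open>y\<close> tends to \<open>x\<close> (with \<open>y = x\<close> allowed) and \<open>t\<close> decreases to 0.  It is valued in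
  \<open>ereal\<close> so that the upper limit always exists; it is finite for locally Lipschitz \<open>f\<close>.\<close>

definition clarke_dir_deriv :: "('a::real_inner \<Rightarrow> real) \<Rightarrow> 'a \<Rightarrow> 'a \<Rightarrow> ereal" where
  "clarke_dir_deriv f x d =
     Limsup (nhds x \<times>\<^sub>F at_right 0) (\<lambda>(y, t::real). ereal ((f (y + t *\<^sub>R d) - f y) / t))"

definition clarke_subdifferential :: "('a::real_inner \<Rightarrow> real) \<Rightarrow> 'a \<Rightarrow> 'a set" where
  "clarke_subdifferential f x = {w. \<forall>d. ereal (w \<bullet> d) \<le> clarke_dir_deriv f x d}"

text \<open>An \<open>n\<close> by \<open>p\<close> matrix has type \<open>real ^ 'p ^ 'n\<close>.  The library norm and inner product of this
  type are the Frobenius ones:\<close>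

lemma norm_matrix_eq_frobenius:
  fixes X :: "real ^ 'p ^ 'n"
  shows "norm X = sqrt (\<Sum>i\<in>UNIV. \<Sum>j\<in>UNIV. (X $ i $ j)\<^sup>2)"
  by (simp add: norm_vec_def L2_set_def sum_nonneg)

lemma inner_matrix_eq_frobenius:
  fixes X Y :: "real ^ 'p ^ 'n"
  shows "X \<bullet> Y = (\<Sum>i\<in>UNIV. \<Sum>j\<in>UNIV. X $ i $ j * Y $ i $ j)"
  by (simp add: inner_vec_def)

definition stiefel :: "(real ^ 'p ^ 'n) set" where
  "stiefel = {X. transpose X ** X = mat 1}"

definition Omega :: "real \<Rightarrow> (real ^ 'p ^ 'n) set" where
  "Omega r = {X. norm (transpose X ** X - mat 1) \<le> r}"

definition dissolve :: "real ^ 'p ^ 'n \<Rightarrow> real ^ 'p ^ 'n" where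
  "dissolve X = (1 / 8) *\<^sub>R
     (X ** (15 *\<^sub>R mat 1 - 10 *\<^sub>R (transpose X ** X)
            + 3 *\<^sub>R ((transpose X ** X) ** (transpose X ** X))))"

definition penalty_fun :: "(real ^ 'p ^ 'n \<Rightarrow> real) \<Rightarrow> real \<Rightarrow> real ^ 'p ^ 'n \<Rightarrow> real" where
  "penalty_fun f \<beta> X = f (dissolve X) + \<beta> / 4 * (norm (transpose X ** X - mat 1))\<^sup>2"

text \<open>The supremum is taken in \<open>[0, \<infinity>]\<close>, so that it is 0 in the degenerate case \<open>Omega 1 = {}\<close>
  (possible only for \<open>p > n\<close>, where \<open>stiefel\<close> is empty too), whereas the supremum of the empty
  set of reals is unspecified.  It is finite for locally Lipschitz \<open>f\<close>.\<close>

definition M1 :: "(real ^ 'p ^ 'n \<Rightarrow> real) \<Rightarrow> ennreal" where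
  "M1 f = Sup {ennreal (norm W) | X W. X \<in> Omega 1 \<and> W \<in> clarke_subdifferential f X}"

end

theory Submission
  imports Defs
begin

text \<open>
  Write \<open>D = X\<^sup>T X - I\<close>.  Then \<open>dissolve X = X (I - D/2 + 3/8 D\<^sup>2)\<close>, where the second factor is the
  second order expansion of \<open>(X\<^sup>T X)\<^bsup>-1/2\<^esup> = (I + D)\<^bsup>-1/2\<^esup>\<close>, so the defect of \<open>dissolve X\<close> is
  cubic in \<open>D\<close>.

  For the first claim move along the curve \<open>X (I - t D)\<close>: at \<open>t = 0\<close> the penalty decreases at rate
  \<open>\<beta> \<parallel>X D\<parallel>\<^sup>2\<close>, whereas \<open>dissolve\<close> moves only with velocity \<open>- 15/8 X D\<^sup>3\<close>.  The generalized
  directional derivative is the support function of the Clarke subdifferential, so \<open>f \<circ> dissolve\<close>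
  increases at rate at most \<open>15/8 M\<^sub>1 \<parallel>X D\<parallel> \<parallel>D\<parallel>\<^sup>2\<close>.  At a local minimizer this gives
  \<open>\<beta> \<parallel>X D\<parallel> \<le> 15/8 M\<^sub>1 \<parallel>D\<parallel>\<^sup>2\<close>; as \<open>\<parallel>X D\<parallel> \<ge> \<parallel>D\<parallel>/2\<close>, the bound on \<open>r\<close> forces \<open>D = 0\<close>.

  For the second claim, a point \<open>Z\<close> near a constrained minimizer has a point of the Stiefel manifold
  within \<open>O(\<parallel>D\<parallel>\<^sup>3)\<close> of \<open>dissolve Z\<close>, so \<open>f (dissolve Z)\<close> loses at most \<open>O(\<parallel>D\<parallel>\<^sup>3)\<close> against the
  minimum, which the penalty \<open>\<beta>/4 \<parallel>D\<parallel>\<^sup>2\<close> outweighs.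
\<close>

subsection \<open>The Clarke directional derivative\<close>

lemma eventually_prod_at_right_pos: "\<forall>\<^sub>F (y, t) in F \<times>\<^sub>F at_right (0::real). t > 0"
  unfolding case_prod_beta
  by (intro eventually_compose_filterlim[OF eventually_at_right_less filterlim_snd])

lemma clarke_dir_deriv_le_iff:
  "clarke_dir_deriv f x d \<le> ereal c \<longleftrightarrow>
    (\<forall>\<epsilon>>0. \<forall>\<^sub>F (y, t) in nhds x \<times>\<^sub>F at_right 0. f (y + t *\<^sub>R d) - f y < t * (c + \<epsilon>))"
proof -
  let ?F = "nhds x \<times>\<^sub>F at_right (0::real)"
  let ?q = "\<lambda>(y, t::real). ereal ((f (y + t *\<^sub>R d) - f y) / t)"
  have "clarke_dir_deriv f x d \<le> ereal c \<longleftrightarrow> (\<forall>z>ereal c. \<forall>\<^sub>F u in ?F. ?q u < z)"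
    unfolding clarke_dir_deriv_def by (rule Limsup_le_iff)
  also have "\<dots> \<longleftrightarrow> (\<forall>\<epsilon>>0. \<forall>\<^sub>F u in ?F. ?q u < ereal (c + \<epsilon>))"
  proof (intro iffI allI impI)
    fix z assume real_bound: "\<forall>\<epsilon>>0. \<forall>\<^sub>F u in ?F. ?q u < ereal (c + \<epsilon>)" and "ereal c < z"
    then obtain w where w: "c < w" "ereal w < z"
      by (metis ereal_dense2 less_ereal.simps(1))
    then have "\<forall>\<^sub>F u in ?F. ?q u < ereal (c + (w - c))"
      by (intro real_bound[rule_format]) simp
    then show "\<forall>\<^sub>F u in ?F. ?q u < z"
      by (rule eventually_mono) (use w in \<open>auto intro: less_trans\<close>)
  qed auto
  also have "\<dots> \<longleftrightarrow> (\<forall>\<epsilon>>0. \<forall>\<^sub>F (y, t) in ?F. f (y + t *\<^sub>R d) - f y < t * (c + \<epsilon>))"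
  proof -
    have "(\<forall>\<^sub>F u in ?F. ?q u < ereal (c + \<epsilon>)) \<longleftrightarrow>
        (\<forall>\<^sub>F (y, t) in ?F. f (y + t *\<^sub>R d) - f y < t * (c + \<epsilon>))" for \<epsilon>
      by (rule eventually_subst, rule eventually_mono[OF eventually_prod_at_right_pos])
        (auto simp: pos_divide_less_eq mult.commute)
    then show ?thesis by simp
  qed
  finally show ?thesis .
qed

lemma tendsto_translate_along:
  fixes x d :: "'a::real_normed_vector"
  shows "((\<lambda>(y, t). y + t *\<^sub>R d) \<longlongrightarrow> x) (nhds x \<times>\<^sub>F at_right 0)"
proof -
  have "(snd \<longlongrightarrow> (0::real)) (nhds x \<times>\<^sub>F at_right 0)"
    by (rule filterlim_compose[OF tendsto_ident_at filterlim_snd])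
  then have "((\<lambda>u. fst u + snd u *\<^sub>R d) \<longlongrightarrow> x + 0 *\<^sub>R d) (nhds x \<times>\<^sub>F at_right (0::real))"
    by (intro tendsto_intros filterlim_fst)
  then show ?thesis
    by (simp add: case_prod_beta')
qed

lemma clarke_dir_deriv_scaleR_le:
  assumes "clarke_dir_deriv f x d \<le> ereal c" "s > 0"
  shows "clarke_dir_deriv f x (s *\<^sub>R d) \<le> ereal (s * c)"
  unfolding clarke_dir_deriv_le_iff
proof (intro allI impI)
  let ?F = "nhds x \<times>\<^sub>F at_right (0::real)"
  fix \<epsilon> :: real assume "\<epsilon> > 0"
  have rescale: "filterlim (\<lambda>(y, t). (y, s * t)) ?F ?F"
    unfolding case_prod_beta'
    using \<open>s > 0\<close> by (intro filterlim_Pair filterlim_fst filterlim_times_pos[OF filterlim_snd]) auto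
  have "\<forall>\<^sub>F (y, t) in ?F. f (y + t *\<^sub>R d) - f y < t * (c + \<epsilon> / s)"
    using assms \<open>\<epsilon> > 0\<close> by (simp add: clarke_dir_deriv_le_iff)
  from eventually_compose_filterlim[OF this rescale]
  show "\<forall>\<^sub>F (y, t) in ?F. f (y + t *\<^sub>R s *\<^sub>R d) - f y < t * (s * c + \<epsilon>)"
  proof (rule eventually_mono, clarify)
    fix y t assume "f (y + (s * t) *\<^sub>R d) - f y < s * t * (c + \<epsilon> / s)"
    also have "s * t * (c + \<epsilon> / s) = t * (s * c + \<epsilon>)"
      using \<open>s > 0\<close> by (simp add: field_simps)
    finally show "f (y + t *\<^sub>R s *\<^sub>R d) - f y < t * (s * c + \<epsilon>)"
      by (simp add: mult.commute)
  qed
qed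

lemma clarke_dir_deriv_add_le:
  assumes "clarke_dir_deriv f x d \<le> ereal a" "clarke_dir_deriv f x e \<le> ereal b"
  shows "clarke_dir_deriv f x (d + e) \<le> ereal (a + b)"
  unfolding clarke_dir_deriv_le_iff
proof (intro allI impI)
  let ?F = "nhds x \<times>\<^sub>F at_right (0::real)"
  fix \<epsilon> :: real assume "\<epsilon> > 0"
  then have along_d: "\<forall>\<^sub>F (y, t) in ?F. f (y + t *\<^sub>R d) - f y < t * (a + \<epsilon> / 2)"
    and along_e: "\<forall>\<^sub>F (y, t) in ?F. f (y + t *\<^sub>R e) - f y < t * (b + \<epsilon> / 2)"
    using assms half_gt_zero unfolding clarke_dir_deriv_le_iff by blast+
  have "filterlim (\<lambda>(y, t). (y + t *\<^sub>R d, t)) ?F ?F"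
    unfolding case_prod_beta'
    using tendsto_translate_along[of d x] filterlim_snd
    by (intro filterlim_Pair) (auto simp: case_prod_beta')
  from eventually_compose_filterlim[OF along_e this] along_d
  show "\<forall>\<^sub>F (y, t) in ?F. f (y + t *\<^sub>R (d + e)) - f y < t * (a + b + \<epsilon>)"
    by eventually_elim (auto simp: algebra_simps)
qed

lemma abs_clarke_dir_deriv_le:
  assumes lip: "L-lipschitz_on (ball x r) f" and "r > 0"
  shows "\<bar>clarke_dir_deriv f x d\<bar> \<le> ereal (L * norm d)"
proof -
  let ?F = "nhds x \<times>\<^sub>F at_right (0::real)"
  let ?q = "\<lambda>(y, t::real). ereal ((f (y + t *\<^sub>R d) - f y) / t)"
  have "\<forall>\<^sub>F (y, t) in ?F. y \<in> ball x r" "\<forall>\<^sub>F (y, t) in ?F. y + t *\<^sub>R d \<in> ball x r"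
    using topological_tendstoD[OF filterlim_fst, of "ball x r" x]
      topological_tendstoD[OF tendsto_translate_along, of "ball x r" x] \<open>r > 0\<close>
    by (auto simp: case_prod_beta')
  with eventually_prod_at_right_pos have quotient_bound:
    "\<forall>\<^sub>F u in ?F. ?q u \<le> ereal (L * norm d) \<and> ereal (- (L * norm d)) \<le> ?q u"
  proof eventually_elim
    case (elim u)
    obtain y t where u: "u = (y, t)" by fastforce
    then have "\<bar>f (y + t *\<^sub>R d) - f y\<bar> \<le> L * (t * norm d)"
      using lipschitz_onD[OF lip, of "y + t *\<^sub>R d" y] elim by (simp add: dist_norm)
    then show ?case
      using u elim by (simp add: abs_le_iff pos_divide_le_eq pos_le_divide_eq mult_ac)
  qed
  have "clarke_dir_deriv f x d \<le> ereal (L * norm d)"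
    unfolding clarke_dir_deriv_def
    by (intro Limsup_bounded eventually_mono[OF quotient_bound]) blast
  moreover have "ereal (- (L * norm d)) \<le> clarke_dir_deriv f x d"
    unfolding clarke_dir_deriv_def
    by (intro le_Limsup eventually_mono[OF quotient_bound]) (auto simp: prod_filter_eq_bot)
  ultimately show ?thesis
    by (cases "clarke_dir_deriv f x d") auto
qed

lemma clarke_dir_deriv_along_curve:
  fixes \<phi> :: "real \<Rightarrow> 'a::real_inner"
  assumes lip: "L-lipschitz_on (ball (\<phi> 0) r) f" and "r > 0"
    and \<phi>: "(\<phi> has_vector_derivative v) (at_right 0)"
    and "clarke_dir_deriv f (\<phi> 0) v \<le> ereal c" and "\<epsilon> > 0"
  shows "\<forall>\<^sub>F t in at_right 0. f (\<phi> t) - f (\<phi> 0) \<le> t * (c + \<epsilon>)"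
proof -
  define \<psi> where "\<psi> = (\<lambda>t. \<phi> 0 + t *\<^sub>R v)"
  have "\<forall>\<^sub>F (y, t) in nhds (\<phi> 0) \<times>\<^sub>F at_right 0. f (y + t *\<^sub>R v) - f y < t * (c + \<epsilon> / 2)"
    using assms by (simp add: clarke_dir_deriv_le_iff)
  moreover have "filterlim (\<lambda>t. (\<phi> 0, t)) (nhds (\<phi> 0) \<times>\<^sub>F at_right 0) (at_right 0)"
    by (intro filterlim_Pair filterlim_ident tendsto_const)
  ultimately have tangent: "\<forall>\<^sub>F t in at_right 0. f (\<psi> t) - f (\<phi> 0) < t * (c + \<epsilon> / 2)"
    using eventually_compose_filterlim unfolding \<psi>_def by fastforce
  have "(\<phi> \<longlongrightarrow> \<phi> 0) (at_right 0)"
    using has_vector_derivative_continuous[OF \<phi>] by (simp add: continuous_within)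
  then have \<phi>_near: "\<forall>\<^sub>F t in at_right 0. \<phi> t \<in> ball (\<phi> 0) r"
    using \<open>r > 0\<close> by (intro topological_tendstoD) auto
  have "(\<psi> \<longlongrightarrow> \<phi> 0 + 0 *\<^sub>R v) (at_right 0)"
    unfolding \<psi>_def by (intro tendsto_intros)
  then have \<psi>_near: "\<forall>\<^sub>F t in at_right 0. \<psi> t \<in> ball (\<phi> 0) r"
    using \<open>r > 0\<close> by (intro topological_tendstoD) auto
  have "((\<lambda>t. L * (norm (\<phi> t - \<psi> t) / norm t)) \<longlongrightarrow> L * 0) (at_right 0)"
    using \<phi> unfolding has_vector_derivative_def has_derivative_iff_norm \<psi>_def
    by (intro tendsto_mult_left) (simp add: algebra_simps)
  then have remainder: "\<forall>\<^sub>F t in at_right 0. L * (norm (\<phi> t - \<psi> t) / norm t) < \<epsilon> / 2"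
    using \<open>\<epsilon> > 0\<close> by (intro order_tendstoD) auto
  show ?thesis
    using tangent \<phi>_near \<psi>_near remainder eventually_at_right_less
  proof eventually_elim
    case (elim t)
    have "f (\<phi> t) - f (\<psi> t) \<le> L * norm (\<phi> t - \<psi> t)"
      using lipschitz_onD[OF lip, of "\<phi> t" "\<psi> t"] elim by (simp add: dist_norm)
    also have "\<dots> \<le> t * (\<epsilon> / 2)"
      using elim by (simp add: field_simps)
    finally show ?case
      using elim by (simp add: algebra_simps)
  qed
qed

lemma clarke_dir_deriv_optimality:
  fixes \<phi> :: "real \<Rightarrow> 'a::real_inner"
  assumes "L-lipschitz_on (ball (\<phi> 0) r) f" "r > 0"
    and "(\<phi> has_vector_derivative v) (at_right 0)"
    and g: "(g has_real_derivative g') (at_right 0)"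
    and min: "\<forall>\<^sub>F t in at_right 0. f (\<phi> 0) + g 0 \<le> f (\<phi> t) + g t"
    and "clarke_dir_deriv f (\<phi> 0) v \<le> ereal c"
  shows "0 \<le> c + g'"
proof (rule field_le_epsilon)
  fix \<epsilon> :: real assume "\<epsilon> > 0"
  have "\<forall>\<^sub>F t in at_right 0. f (\<phi> t) - f (\<phi> 0) \<le> t * (c + \<epsilon>)"
    using assms \<open>\<epsilon> > 0\<close> by (intro clarke_dir_deriv_along_curve)
  then have "\<forall>\<^sub>F t in at_right 0. 0 \<le> c + \<epsilon> + (g t - g 0) / (t - 0)"
    using min eventually_at_right_less
  proof eventually_elim
    case (elim t)
    then have "0 \<le> t * (c + \<epsilon>) + (g t - g 0)"
      by simp
    then have "0 \<le> (t * (c + \<epsilon>) + (g t - g 0)) / t"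
      using elim by simp
    then show ?case
      using elim by (simp add: add_divide_distrib)
  qed
  moreover have "((\<lambda>t. c + \<epsilon> + (g t - g 0) / (t - 0)) \<longlongrightarrow> c + \<epsilon> + g') (at_right 0)"
    using g by (intro tendsto_intros) (simp add: has_field_derivative_iff)
  ultimately have "0 \<le> c + \<epsilon> + g'"
    by (intro tendsto_lowerbound) auto
  then show "0 \<le> c + g' + \<epsilon>"
    by simp
qed

subsection \<open>The Clarke subdifferential\<close>

lemma convex_strict_epigraph:
  assumes "convex_on S f"
  shows "convex {u. fst u \<in> S \<and> f (fst u) < snd u}"
proof (rule convexI)
  let ?E = "{u. fst u \<in> S \<and> f (fst u) < snd u}"
  fix u v and a b :: real
  assume uv: "u \<in> ?E" "v \<in> ?E" and ab: "0 \<le> a" "0 \<le> b" "a + b = 1"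
  then have "f (a *\<^sub>R fst u + b *\<^sub>R fst v) \<le> a * f (fst u) + b * f (fst v)"
    using assms by (simp add: convex_on_def)
  also have "\<dots> < a * snd u + b * snd v"
    using uv ab by (cases "a = 0") (auto intro!: add_less_le_mono mult_left_mono)
  finally have "f (a *\<^sub>R fst u + b *\<^sub>R fst v) < a * snd u + b * snd v" .
  moreover have "a *\<^sub>R fst u + b *\<^sub>R fst v \<in> S"
    using assms uv ab by (intro convexD) (auto simp: convex_on_imp_convex)
  ultimately show "a *\<^sub>R u + b *\<^sub>R v \<in> ?E"
    by simp
qed

lemma convex_on_UNIV_subgradient:
  fixes p :: "'a::euclidean_space \<Rightarrow> real"
  assumes "convex_on UNIV p"
  obtains w where "\<And>y. p x + w \<bullet> (y - x) \<le> p y"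
proof -
  define S where "S = {u. p (fst u) < snd u}"
  have "convex S"
    using convex_strict_epigraph[OF assms] by (simp add: S_def)
  moreover have "(x, p x + 1) \<in> S" "(x, p x) \<notin> S"
    by (simp_all add: S_def)
  ultimately obtain n c where "n \<noteq> 0" and S_below: "\<And>u. u \<in> S \<Longrightarrow> n \<bullet> u \<le> c"
    and "c \<le> n \<bullet> (x, p x)"
    using separating_hyperplane_sets[of S "{(x, p x)}"] by blast
  obtain a b where n: "n = (a, b)" by fastforce
  have above_graph: "a \<bullet> y + b * s \<le> a \<bullet> x + b * p x" if "p y < s" for y s
    using S_below[of "(y, s)"] that \<open>c \<le> n \<bullet> (x, p x)\<close> by (simp add: n S_def)
  have "b \<le> 0"
    using above_graph[of x "p x + 1"] by (simp add: algebra_simps)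
  moreover have "b \<noteq> 0"
  proof
    assume "b = 0"
    then have "a = 0"
      using above_graph[of "x + a" "p (x + a) + 1"]
      by (simp add: inner_add_right flip: power2_norm_eq_inner)
    with \<open>b = 0\<close> \<open>n \<noteq> 0\<close> show False
      by (simp add: n zero_prod_def)
  qed
  ultimately have "b < 0" by simp
  have "a \<bullet> (y - x) \<le> b * (p x - p y)" for y
  proof -
    have "a \<bullet> y - a \<bullet> x + b * (p y - p x) \<le> e" if "e > 0" for e
      using above_graph[of y "p y - e / b"] \<open>b < 0\<close> that by (simp add: algebra_simps divide_pos_neg)
    then have "a \<bullet> y - a \<bullet> x + b * (p y - p x) \<le> 0"
      by (rule field_le_epsilon) simp
    then show ?thesis
      by (simp add: algebra_simps)
  qed
  then have "p x + ((- 1 / b) *\<^sub>R a) \<bullet> (y - x) \<le> p y" for y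
    using \<open>b < 0\<close> by (simp add: field_simps)
  then show thesis
    by (rule that)
qed

lemma sublinear_supporting_functional:
  fixes p :: "'a::euclidean_space \<Rightarrow> real"
  assumes add: "\<And>x y. p (x + y) \<le> p x + p y"
    and scale: "\<And>s x. s \<ge> 0 \<Longrightarrow> p (s *\<^sub>R x) \<le> s * p x"
  obtains w where "w \<bullet> d = p d" "\<And>x. w \<bullet> x \<le> p x"
proof -
  have "convex_on UNIV p"
  proof (rule convex_onI)
    fix t x y assume "0 < t" "t < (1::real)"
    then show "p ((1 - t) *\<^sub>R x + t *\<^sub>R y) \<le> (1 - t) * p x + t * p y"
      using add[of "(1 - t) *\<^sub>R x" "t *\<^sub>R y"] scale[of "1 - t" x] scale[of t y] by linarith
  qed simp
  then obtain w where w: "\<And>x. p d + w \<bullet> (x - d) \<le> p x"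
    using convex_on_UNIV_subgradient by blast
  have "p 0 \<le> 0" "p (2 *\<^sub>R d) \<le> 2 * p d"
    using scale[of 0 0] scale[of 2 d] by simp_all
  then have "w \<bullet> d = p d"
    using w[of 0] w[of "2 *\<^sub>R d"] by (simp add: algebra_simps)
  moreover from this have "w \<bullet> x \<le> p x" for x
    using w[of x] by (simp add: inner_diff_right)
  ultimately show thesis
    by (rule that)
qed

lemma clarke_dir_deriv_attained:
  fixes f :: "'a::euclidean_space \<Rightarrow> real"
  assumes "L-lipschitz_on (ball x r) f" "r > 0"
  obtains w where "w \<in> clarke_subdifferential f x" "ereal (w \<bullet> d) = clarke_dir_deriv f x d"
proof -
  define p where "p = (\<lambda>d. real_of_ereal (clarke_dir_deriv f x d))"
  have p: "clarke_dir_deriv f x d = ereal (p d)" for d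
    using abs_clarke_dir_deriv_le[OF assms, of d]
    by (cases "clarke_dir_deriv f x d") (auto simp: p_def)
  have "p (u + v) \<le> p u + p v" for u v
    using clarke_dir_deriv_add_le[of f x u "p u" v "p v"] by (simp add: p)
  moreover have "p (s *\<^sub>R u) \<le> s * p u" if "s \<ge> 0" for s u
  proof (cases "s = 0")
    case True
    then show ?thesis
      using abs_clarke_dir_deriv_le[OF assms, of 0] by (simp add: p)
  next
    case False
    then show ?thesis
      using clarke_dir_deriv_scaleR_le[of f x u "p u" s] that by (simp add: p)
  qed
  ultimately obtain w where "w \<bullet> d = p d" "\<And>e. w \<bullet> e \<le> p e"
    using sublinear_supporting_functional by blast
  then show thesis
    using that[of w] by (simp add: clarke_subdifferential_def p)
qed

lemma clarke_dir_deriv_le_norm: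
  fixes f :: "'a::euclidean_space \<Rightarrow> real"
  assumes "L-lipschitz_on (ball x r) f" "r > 0"
    and M: "\<And>w. w \<in> clarke_subdifferential f x \<Longrightarrow> norm w \<le> M"
  shows "clarke_dir_deriv f x d \<le> ereal (M * norm d)"
proof -
  obtain w where w: "w \<in> clarke_subdifferential f x" "ereal (w \<bullet> d) = clarke_dir_deriv f x d"
    using clarke_dir_deriv_attained assms(1,2) .
  have "w \<bullet> d \<le> norm w * norm d"
    by (rule norm_cauchy_schwarz)
  also have "\<dots> \<le> M * norm d"
    using M[OF w(1)] by (rule mult_right_mono) simp
  finally show ?thesis
    by (simp flip: w(2))
qed

subsection \<open>Local minimizers and error bounds\<close>

lemma local_minimizer_on_UNIV_iff:
  "local_minimizer_on f UNIV x \<longleftrightarrow> (\<forall>\<^sub>F z in nhds x. f x \<le> f z)"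
  by (simp add: local_minimizer_on_def eventually_nhds_metric)

lemma local_minimizer_on_subset:
  assumes "local_minimizer_on g T x" "x \<in> S" "S \<subseteq> T" "\<And>z. z \<in> S \<Longrightarrow> f z = g z"
  shows "local_minimizer_on f S x"
  using assms unfolding local_minimizer_on_def by (metis subsetD)

lemma local_minimizer_on_eventually_le:
  assumes min: "local_minimizer_on f S x"
    and lip: "L-lipschitz_on (ball x r) f" and "r > 0"
    and A: "(A \<longlongrightarrow> x) F" and \<epsilon>: "(\<epsilon> \<longlongrightarrow> 0) F"
    and near_S: "\<forall>\<^sub>F z in F. \<exists>p\<in>S. dist p (A z) \<le> \<epsilon> z"
  shows "\<forall>\<^sub>F z in F. f x \<le> f (A z) + L * \<epsilon> z"
proof -
  from min obtain e where "e > 0" and e: "\<And>z. z \<in> S \<Longrightarrow> dist z x < e \<Longrightarrow> f x \<le> f z"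
    unfolding local_minimizer_on_def by blast
  define \<rho> where "\<rho> = min r e"
  have "\<rho> / 2 > 0"
    using \<open>r > 0\<close> \<open>e > 0\<close> by (simp add: \<rho>_def)
  have "\<forall>\<^sub>F z in F. dist (A z) x < \<rho> / 2" "\<forall>\<^sub>F z in F. \<epsilon> z < \<rho> / 2"
    using tendstoD[OF A \<open>\<rho> / 2 > 0\<close>] order_tendstoD(2)[OF \<epsilon> \<open>\<rho> / 2 > 0\<close>] .
  then show ?thesis
    using near_S
  proof eventually_elim
    case (elim z)
    then obtain p where "p \<in> S" and p: "dist p (A z) \<le> \<epsilon> z"
      by blast
    then have "dist p x < \<rho>"
      using elim dist_triangle[of p x "A z"] by linarith
    then have "f x \<le> f p"
      using \<open>p \<in> S\<close> by (intro e) (simp_all add: \<rho>_def)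
    also have "\<dots> \<le> f (A z) + L * dist p (A z)"
      using lipschitz_onD[OF lip, of p "A z"] \<open>dist p x < \<rho>\<close> elim \<open>\<rho> / 2 > 0\<close>
      by (simp add: \<rho>_def dist_real_def dist_commute abs_le_iff)
    also have "L * dist p (A z) \<le> L * \<epsilon> z"
      using p lipschitz_on_nonneg[OF lip] by (rule mult_left_mono)
    finally show ?case
      by simp
  qed
qed

text \<open>The Lipschitz loss \<open>L C d\<^bsup>k+1\<^esup>\<close> of passing from \<open>A z\<close> to a nearby point of \<open>S\<close> is of higher
  order than the penalty \<open>\<beta> d\<^bsup>k\<^esup>\<close>.\<close>

lemma local_minimizer_on_imp_penalized:
  assumes "local_minimizer_on f S x"
    and "L-lipschitz_on (ball x r) f" "r > 0" and "\<beta> > 0" "k > 0"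
    and A: "isCont A x" "A x = x"
    and d: "isCont d x" "d x = 0" "\<And>z. d z \<ge> 0"
    and "\<forall>\<^sub>F z in nhds x. \<exists>p\<in>S. dist p (A z) \<le> C * d z ^ Suc k"
  shows "local_minimizer_on (\<lambda>z. f (A z) + \<beta> * d z ^ k) UNIV x"
proof -
  have A_lim: "(A \<longlongrightarrow> x) (nhds x)" and d_lim: "(d \<longlongrightarrow> 0) (nhds x)"
    using A d by (simp_all add: isCont_def tendsto_nhds_iff)
  have "((\<lambda>z. C * d z ^ Suc k) \<longlongrightarrow> C * 0 ^ Suc k) (nhds x)"
    by (intro tendsto_intros d_lim)
  then have "\<forall>\<^sub>F z in nhds x. f x \<le> f (A z) + L * (C * d z ^ Suc k)"
    using assms A_lim by (intro local_minimizer_on_eventually_le) simp_all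
  moreover have "((\<lambda>z. L * (C * d z)) \<longlongrightarrow> L * (C * 0)) (nhds x)"
    by (intro tendsto_intros d_lim)
  then have "\<forall>\<^sub>F z in nhds x. L * (C * d z) < \<beta>"
    using \<open>\<beta> > 0\<close> by (simp add: order_tendstoD(2))
  ultimately have "\<forall>\<^sub>F z in nhds x. f x \<le> f (A z) + \<beta> * d z ^ k"
  proof eventually_elim
    case (elim z)
    have "L * (C * d z ^ Suc k) = L * (C * d z) * d z ^ k"
      by simp
    also have "\<dots> \<le> \<beta> * d z ^ k"
      using elim d(3) by (intro mult_right_mono) auto
    finally show ?case
      using elim by simp
  qed
  then show ?thesis
    using A d \<open>k > 0\<close> by (simp add: local_minimizer_on_UNIV_iff zero_power)
qed

lemma dist_le_telescoping:
  fixes b :: "nat \<Rightarrow> real"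
  assumes "\<And>k. dist (z k) (z (Suc k)) \<le> b k - b (Suc k)" and "m \<le> n"
  shows "dist (z m) (z n) \<le> b m - b n"
  using \<open>m \<le> n\<close>
proof (induction n rule: dec_induct)
  case (step n)
  then show ?case
    using assms(1)[of n] dist_triangle[of "z m" "z (Suc n)" "z n"] by linarith
qed simp

lemma telescoping_dist_convergent:
  fixes z :: "nat \<Rightarrow> 'a::complete_space" and b :: "nat \<Rightarrow> real"
  assumes step: "\<And>k. dist (z k) (z (Suc k)) \<le> b k - b (Suc k)" and "\<And>k. 0 \<le> b k"
  obtains p where "z \<longlonglongrightarrow> p" "dist (z 0) p \<le> b 0"
proof -
  have "decseq b"
    using order_trans[OF zero_le_dist step] by (intro decseq_SucI) simp
  then have "Cauchy b"
    using assms(2) by (metis decseq_convergent LIMSEQ_imp_Cauchy)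
  have "Cauchy z"
  proof (rule CauchyI')
    fix e :: real assume "e > 0"
    then obtain N where "\<And>m n. m \<ge> N \<Longrightarrow> n \<ge> N \<Longrightarrow> dist (b m) (b n) < e"
      using \<open>Cauchy b\<close> unfolding Cauchy_def by blast
    moreover have "dist (z m) (z n) \<le> dist (b m) (b n)" if "m < n" for m n
      using dist_le_telescoping[of z b m n, OF step] that by (simp add: dist_real_def)
    ultimately have "dist (z m) (z n) < e" if "m \<ge> N" "m < n" for m n
      using that by (meson le_less_trans less_imp_le order_trans)
    then show "\<exists>N. \<forall>m\<ge>N. \<forall>n>m. dist (z m) (z n) < e"
      by blast
  qed
  then obtain p where "z \<longlonglongrightarrow> p"
    by (auto simp: Cauchy_convergent_iff convergent_def)
  moreover have "dist (z 0) (z n) \<le> b 0" for n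
    using dist_le_telescoping[of z b 0 n, OF step] assms(2)[of n] by simp
  then have "dist (z 0) p \<le> b 0"
    by (intro LIMSEQ_le_const2[OF tendsto_dist[OF tendsto_const \<open>z \<longlonglongrightarrow> p\<close>]]) auto
  ultimately show thesis
    by (rule that)
qed

subsection \<open>Frobenius norm and matrix algebra\<close>

lemma norm_matrix_mult_le:
  fixes A :: "real ^ 'm ^ 'n" and B :: "real ^ 'k ^ 'm"
  shows "norm (A ** B) \<le> norm A * norm B"
proof (rule power2_le_imp_le)
  have sq: "(norm C)\<^sup>2 = (\<Sum>i\<in>UNIV. \<Sum>j\<in>UNIV. (C $ i $ j)\<^sup>2)" for C :: "real ^ 'x ^ 'y"
    by (simp add: norm_matrix_eq_frobenius sum_nonneg)
  have "(norm (A ** B))\<^sup>2 \<le>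
      (\<Sum>i\<in>UNIV. \<Sum>j\<in>UNIV. (\<Sum>k\<in>UNIV. (A $ i $ k)\<^sup>2) * (\<Sum>k\<in>UNIV. (B $ k $ j)\<^sup>2))"
    unfolding sq matrix_matrix_mult_def
    by (simp, intro sum_mono Cauchy_Schwarz_ineq_sum)
  also have "\<dots> = (\<Sum>i\<in>UNIV. \<Sum>k\<in>UNIV. (A $ i $ k)\<^sup>2) * (\<Sum>j\<in>UNIV. \<Sum>k\<in>UNIV. (B $ k $ j)\<^sup>2)"
    by (rule sum_product[symmetric])
  also have "\<dots> = (norm A * norm B)\<^sup>2"
    unfolding power_mult_distrib sq by (subst (3) sum.swap) simp
  finally show "(norm (A ** B))\<^sup>2 \<le> (norm A * norm B)\<^sup>2" .
qed simp

lemma bounded_bilinear_matrix_mult [bounded_bilinear]: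
  "bounded_bilinear ((**) :: real ^ 'm ^ 'n \<Rightarrow> real ^ 'k ^ 'm \<Rightarrow> real ^ 'k ^ 'n)"
proof
  show "\<exists>K. \<forall>(A :: real ^ 'm ^ 'n) (B :: real ^ 'k ^ 'm). norm (A ** B) \<le> norm A * norm B * K"
    using norm_matrix_mult_le by (intro exI[of _ 1]) auto
qed (simp_all add: matrix_matrix_mult_def vec_eq_iff algebra_simps sum.distrib sum_distrib_left)

interpretation matrix_mult: bounded_bilinear
  "(**) :: real ^ 'm ^ 'n \<Rightarrow> real ^ 'k ^ 'm \<Rightarrow> real ^ 'k ^ 'n"
  by (rule bounded_bilinear_matrix_mult)

lemmas has_vector_derivative_matrix_mult [derivative_intros] = matrix_mult.has_vector_derivative

lemma bounded_linear_transpose [bounded_linear]: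
  "bounded_linear (transpose :: real ^ 'm ^ 'n \<Rightarrow> real ^ 'n ^ 'm)"
  by (rule linear_conv_bounded_linear[THEN iffD1], rule linearI)
    (simp_all add: transpose_def vec_eq_iff)

lemmas transpose_linear =
  linear_add[OF bounded_linear.linear[OF bounded_linear_transpose]]
  linear_diff[OF bounded_linear.linear[OF bounded_linear_transpose]]
  transpose_scalar

lemmas matrix_algebra_simps = matrix_mult.add_left matrix_mult.add_right matrix_mult.diff_left
  matrix_mult.diff_right matrix_mult.scaleR_left matrix_mult.scaleR_right
  matrix_mult.minus_left matrix_mult.minus_right matrix_mul_assoc scaleR_add_right scaleR_diff_right

lemma inner_matrix_mult_left:
  fixes A :: "real ^ 'm ^ 'n" and B :: "real ^ 'k ^ 'm" and C :: "real ^ 'k ^ 'n"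
  shows "(A ** B) \<bullet> C = B \<bullet> (transpose A ** C)"
proof -
  have columns: "P \<bullet> Q = (\<Sum>j\<in>UNIV. column j P \<bullet> column j Q)" for P Q :: "real ^ 'k ^ 'l"
    by (simp add: inner_matrix_eq_frobenius column_def inner_vec_def) (rule sum.swap)
  have column_mult: "column j (P ** Q) = P *v column j Q"
    for P :: "real ^ 'b ^ 'a" and Q :: "real ^ 'k ^ 'b" and j
    by (simp add: column_def matrix_matrix_mult_def matrix_vector_mult_def)
  have "(A *v b) \<bullet> c = b \<bullet> (transpose A *v c)" for b c
    using dot_lmul_matrix[of c A b] by (simp add: inner_commute)
  then show ?thesis
    by (simp only: columns column_mult)
qed

subsection \<open>The defect of the Gram matrix\<close>

definition gram_defect :: "real ^ 'p ^ 'n \<Rightarrow> real ^ 'p ^ 'p" where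
  "gram_defect X = transpose X ** X - mat 1"

definition isqrt_approx :: "real ^ 'p ^ 'p \<Rightarrow> real ^ 'p ^ 'p" where
  "isqrt_approx D = mat 1 - (1 / 2) *\<^sub>R D + (3 / 8) *\<^sub>R (D ** D)"

lemma stiefel_iff: "X \<in> stiefel \<longleftrightarrow> gram_defect X = 0"
  by (simp add: stiefel_def gram_defect_def)

lemma Omega_iff: "X \<in> Omega r \<longleftrightarrow> norm (gram_defect X) \<le> r"
  by (simp add: Omega_def gram_defect_def)

lemma penalty_fun_eq: "penalty_fun f \<beta> X = f (dissolve X) + \<beta> / 4 * (norm (gram_defect X))\<^sup>2"
  by (simp add: penalty_fun_def gram_defect_def)

lemma gram_eq: "transpose X ** X = mat 1 + gram_defect X"
  by (simp add: gram_defect_def)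

lemma transpose_gram_defect: "transpose (gram_defect X) = gram_defect X"
  by (simp add: gram_defect_def transpose_linear matrix_transpose_mul)

lemma dissolve_eq: "dissolve X = X ** isqrt_approx (gram_defect X)"
  unfolding dissolve_def gram_eq isqrt_approx_def
  by (simp add: matrix_algebra_simps) (simp add: vec_eq_iff)

lemma dissolve_stiefel: "X \<in> stiefel \<Longrightarrow> dissolve X = X"
  by (simp add: stiefel_iff dissolve_eq isqrt_approx_def)

lemma penalty_fun_stiefel: "X \<in> stiefel \<Longrightarrow> penalty_fun f \<beta> X = f X"
  by (simp add: penalty_fun_eq dissolve_stiefel stiefel_iff)

lemma isCont_gram_defect: "isCont gram_defect X"
  unfolding gram_defect_def by (intro continuous_intros)

lemma isCont_dissolve: "isCont dissolve X"
  unfolding dissolve_eq isqrt_approx_def by (intro continuous_intros isCont_gram_defect)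

lemma gram_defect_mult:
  assumes "transpose B = B"
  shows "gram_defect (X ** B) = B ** (mat 1 + gram_defect X) ** B - mat 1"
proof -
  have "transpose (X ** B) ** (X ** B) = B ** (transpose X ** X) ** B"
    by (simp add: matrix_transpose_mul assms matrix_mul_assoc)
  then show ?thesis
    by (simp add: gram_defect_def)
qed

lemma gram_defect_dissolve:
  fixes X :: "real ^ 'p ^ 'n"
  defines "D \<equiv> gram_defect X"
  shows "gram_defect (dissolve X) = (5 / 8) *\<^sub>R (D ** D ** D) - (15 / 64) *\<^sub>R (D ** D ** D ** D)
    + (9 / 64) *\<^sub>R (D ** D ** D ** D ** D)"
proof -
  have "transpose (isqrt_approx D) = isqrt_approx D"
    by (simp add: D_def isqrt_approx_def transpose_linear matrix_transpose_mul transpose_gram_defect)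
  from gram_defect_mult[OF this, of X] show ?thesis
    unfolding dissolve_eq D_def[symmetric] isqrt_approx_def
    by (simp add: matrix_algebra_simps) (simp add: vec_eq_iff)
qed

lemma norm_gram_defect_dissolve_le:
  assumes "norm (gram_defect X) \<le> 1"
  shows "norm (gram_defect (dissolve X)) \<le> norm (gram_defect X) ^ 3"
proof -
  let ?D = "gram_defect X"
  have mult_D: "norm (A ** ?D) \<le> norm ?D ^ Suc k" if "norm A \<le> norm ?D ^ k" for A k
    using norm_matrix_mult_le[of A ?D] mult_right_mono[OF that norm_ge_zero[of ?D]]
    by (simp add: mult.commute)
  have cube: "norm (?D ** ?D ** ?D) \<le> norm ?D ^ 3"
    using mult_D[OF mult_D[of ?D 1]] by (simp add: eval_nat_numeral)
  have fourth: "norm (?D ** ?D ** ?D ** ?D) \<le> norm ?D ^ 4"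
    using mult_D[OF cube] by (simp add: eval_nat_numeral)
  have fifth: "norm (?D ** ?D ** ?D ** ?D ** ?D) \<le> norm ?D ^ 5"
    using mult_D[OF fourth] by (simp add: eval_nat_numeral)
  have "norm (gram_defect (dissolve X)) \<le>
      5 / 8 * norm (?D ** ?D ** ?D) + 15 / 64 * norm (?D ** ?D ** ?D ** ?D)
      + 9 / 64 * norm (?D ** ?D ** ?D ** ?D ** ?D)"
    unfolding gram_defect_dissolve
    by (rule norm_triangle_le, rule add_mono, rule norm_triangle_le_diff) simp_all
  moreover have "norm ?D ^ 4 \<le> norm ?D ^ 3" "norm ?D ^ 5 \<le> norm ?D ^ 3"
    using assms by (auto intro: power_decreasing)
  ultimately show ?thesis
    using cube fourth fifth by linarith
qed

lemma norm_gram_defect_dissolve_le_self: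
  assumes "norm (gram_defect X) \<le> 1"
  shows "norm (gram_defect (dissolve X)) \<le> norm (gram_defect X)"
  using norm_gram_defect_dissolve_le[OF assms] power_decreasing[of 1 3 "norm (gram_defect X)"] assms
  by simp

lemma norm_le_gram_defect:
  fixes X :: "real ^ 'p ^ 'n"
  shows "norm X \<le> norm (mat 1 :: real ^ 'p ^ 'p) + norm (gram_defect X)"
proof (rule power2_le_imp_le)
  let ?I = "mat 1 :: real ^ 'p ^ 'p"
  have "(norm X)\<^sup>2 = ?I \<bullet> (transpose X ** X)"
    using inner_matrix_mult_left[of X ?I X] by (simp add: power2_norm_eq_inner)
  also have "\<dots> \<le> norm ?I * norm (?I + gram_defect X)"
    unfolding gram_eq by (rule norm_cauchy_schwarz)
  also have "\<dots> \<le> (norm ?I + norm (gram_defect X)) * (norm ?I + norm (gram_defect X))"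
    by (intro mult_mono norm_triangle_ineq) auto
  finally show "(norm X)\<^sup>2 \<le> (norm ?I + norm (gram_defect X))\<^sup>2"
    by (simp add: power2_eq_square)
qed simp

lemma norm_dissolve_diff_le:
  assumes "norm (gram_defect X) \<le> 1"
  shows "norm (dissolve X - X) \<le> norm X * norm (gram_defect X)"
proof -
  let ?D = "gram_defect X"
  let ?R = "(3 / 8) *\<^sub>R (?D ** ?D) - (1 / 2) *\<^sub>R ?D"
  have "norm ?R \<le> 3 / 8 * norm (?D ** ?D) + 1 / 2 * norm ?D"
    by (rule norm_triangle_le_diff) simp
  moreover have "norm (?D ** ?D) \<le> norm ?D"
    using norm_matrix_mult_le[of ?D ?D] mult_left_mono[OF assms norm_ge_zero[of ?D]] by simp
  ultimately have "norm ?R \<le> norm ?D"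
    using norm_ge_zero[of ?D] by linarith
  moreover have "dissolve X - X = X ** ?R"
    by (simp add: dissolve_eq isqrt_approx_def matrix_algebra_simps)
  ultimately show ?thesis
    using norm_matrix_mult_le[of X ?R] mult_left_mono[of "norm ?R" "norm ?D" "norm X"] by simp
qed

lemma norm_gram_defect_dissolve_le_half:
  assumes "norm (gram_defect X) \<le> 1 / 2"
  shows "norm (gram_defect (dissolve X)) \<le> norm (gram_defect X) / 2"
proof -
  let ?\<delta> = "norm (gram_defect X)"
  have "norm (gram_defect (dissolve X)) \<le> ?\<delta> * ?\<delta>\<^sup>2"
    using norm_gram_defect_dissolve_le[of X] assms by (simp add: power_numeral_reduce)
  also have "\<dots> \<le> ?\<delta> * (1 / 2)\<^sup>2"
    using assms by (intro mult_left_mono power_mono) simp_all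
  also have "\<dots> \<le> ?\<delta> / 2"
    by (simp add: power2_eq_square)
  finally show ?thesis .
qed

lemma norm_gram_defect_funpow_dissolve_le:
  assumes "norm (gram_defect X) \<le> 1 / 2"
  shows "norm (gram_defect ((dissolve ^^ k) X)) \<le> (1 / 2) ^ Suc k"
proof (induction k)
  case (Suc k)
  have "(1 / 2) ^ Suc k \<le> (1 / 2 :: real)"
    by (simp add: power_le_one)
  then have "norm (gram_defect ((dissolve ^^ k) X)) \<le> 1 / 2"
    using Suc by (rule order_trans[rotated])
  then show ?case
    using norm_gram_defect_dissolve_le_half[of "(dissolve ^^ k) X"] Suc by simp
qed (use assms in simp)

lemma dist_dissolve_le_gram_defect_decrease:
  fixes X :: "real ^ 'p ^ 'n"
  defines "K \<equiv> 2 * (norm (mat 1 :: real ^ 'p ^ 'p) + 1)"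
  assumes small: "norm (gram_defect X) \<le> 1 / 2"
  shows "dist X (dissolve X) \<le> K * norm (gram_defect X) - K * norm (gram_defect (dissolve X))"
proof -
  have "norm X \<le> K / 2"
    using norm_le_gram_defect[of X] small by (simp add: K_def)
  then have "dist X (dissolve X) \<le> K / 2 * norm (gram_defect X)"
    using norm_dissolve_diff_le[of X] small
      mult_right_mono[of "norm X" "K / 2" "norm (gram_defect X)"]
    by (simp add: dist_norm norm_minus_commute)
  moreover have "K * norm (gram_defect (dissolve X)) \<le> K * (norm (gram_defect X) / 2)"
    using norm_gram_defect_dissolve_le_half[OF small]
    by (intro mult_left_mono) (simp_all add: K_def)
  ultimately show ?thesis
    by simp
qed

text \<open>The point is the limit of the iterates of \<open>dissolve\<close>.\<close>

lemma error_bound_stiefel: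
  fixes X :: "real ^ 'p ^ 'n"
  assumes "norm (gram_defect X) \<le> 1 / 2"
  obtains P where "P \<in> stiefel"
    "dist P X \<le> 2 * (norm (mat 1 :: real ^ 'p ^ 'p) + 1) * norm (gram_defect X)"
proof -
  define K where "K = 2 * (norm (mat 1 :: real ^ 'p ^ 'p) + 1)"
  define Z where "Z = (\<lambda>k. (dissolve ^^ k) X)"
  have geometric: "norm (gram_defect (Z k)) \<le> (1 / 2) ^ Suc k" for k
    unfolding Z_def using assms by (rule norm_gram_defect_funpow_dissolve_le)
  have "norm (gram_defect (Z k)) \<le> 1 / 2" for k
    using geometric[of k] power_le_one[of "1 / 2 :: real" k] by simp
  then have "dist (Z k) (Z (Suc k)) \<le>
      K * norm (gram_defect (Z k)) - K * norm (gram_defect (Z (Suc k)))" for k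
    using dist_dissolve_le_gram_defect_decrease[of "Z k"] by (simp add: K_def Z_def)
  moreover have "0 \<le> K * norm (gram_defect (Z k))" for k
    by (simp add: K_def)
  ultimately obtain P where "Z \<longlonglongrightarrow> P" and P: "dist (Z 0) P \<le> K * norm (gram_defect (Z 0))"
    by (rule telescoping_dist_convergent)
  have "(\<lambda>k. gram_defect (Z k)) \<longlonglongrightarrow> gram_defect P"
    using isCont_gram_defect \<open>Z \<longlonglongrightarrow> P\<close> by (rule isCont_tendsto_compose)
  moreover have "(\<lambda>k. (1 / 2 :: real) ^ Suc k) \<longlonglongrightarrow> 0"
    by (intro LIMSEQ_Suc LIMSEQ_realpow_zero) auto
  then have "(\<lambda>k. gram_defect (Z k)) \<longlonglongrightarrow> 0"
    by (rule Lim_null_comparison[rotated]) (use geometric in simp)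
  ultimately have "P \<in> stiefel"
    unfolding stiefel_iff by (rule LIMSEQ_unique)
  then show thesis
    using that[of P] P by (simp add: K_def Z_def dist_commute)
qed

lemma error_bound_stiefel_dissolve:
  fixes X :: "real ^ 'p ^ 'n"
  assumes "norm (gram_defect X) \<le> 1 / 2"
  obtains P where "P \<in> stiefel"
    "dist P (dissolve X) \<le> 2 * (norm (mat 1 :: real ^ 'p ^ 'p) + 1) * norm (gram_defect X) ^ 3"
proof -
  let ?K = "2 * (norm (mat 1 :: real ^ 'p ^ 'p) + 1)"
  have "norm (gram_defect (dissolve X)) \<le> 1 / 2"
    using norm_gram_defect_dissolve_le_self[of X] assms by simp
  then obtain P where "P \<in> stiefel" "dist P (dissolve X) \<le> ?K * norm (gram_defect (dissolve X))"
    by (rule error_bound_stiefel)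
  moreover have "?K * norm (gram_defect (dissolve X)) \<le> ?K * norm (gram_defect X) ^ 3"
    using assms by (intro mult_left_mono norm_gram_defect_dissolve_le) simp_all
  ultimately show thesis
    using that order_trans by blast
qed

subsection \<open>The curve of decreasing defect\<close>

definition defect_curve :: "real ^ 'p ^ 'n \<Rightarrow> real \<Rightarrow> real ^ 'p ^ 'n" where
  "defect_curve X t = X ** (mat 1 - t *\<^sub>R gram_defect X)"

lemma defect_curve_0: "defect_curve X 0 = X"
  by (simp add: defect_curve_def)

lemma gram_defect_defect_curve_has_vector_derivative:
  fixes X :: "real ^ 'p ^ 'n"
  defines "D \<equiv> gram_defect X"
  shows "((\<lambda>t. gram_defect (defect_curve X t)) has_vector_derivative (- 2) *\<^sub>R (D + D ** D)) (at 0)"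
proof -
  have "transpose (mat 1 - t *\<^sub>R D) = mat 1 - t *\<^sub>R D" for t
    by (simp add: D_def transpose_linear transpose_gram_defect)
  then have "gram_defect (defect_curve X t) =
      (mat 1 - t *\<^sub>R D) ** (mat 1 + D) ** (mat 1 - t *\<^sub>R D) - mat 1" for t
    by (simp add: defect_curve_def gram_defect_mult D_def)
  moreover have "((\<lambda>t. (mat 1 - t *\<^sub>R D) ** (mat 1 + D) ** (mat 1 - t *\<^sub>R D) - mat 1)
      has_vector_derivative (- 2) *\<^sub>R (D + D ** D)) (at 0)"
    by (auto intro!: derivative_eq_intros simp: matrix_algebra_simps) (simp add: vec_eq_iff)
  ultimately show ?thesis
    by simp
qed

lemma dissolve_defect_curve_has_vector_derivative:
  fixes X :: "real ^ 'p ^ 'n"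
  defines "D \<equiv> gram_defect X"
  shows "((\<lambda>t. dissolve (defect_curve X t))
    has_vector_derivative - (15 / 8) *\<^sub>R (X ** D ** D ** D)) (at 0)"
proof -
  note gram_defect_defect_curve_has_vector_derivative[of X, folded D_def, derivative_intros]
  have "((\<lambda>t. X ** (mat 1 - t *\<^sub>R D)) has_vector_derivative - (X ** D)) (at 0)"
    by (auto intro!: derivative_eq_intros simp: matrix_algebra_simps)
  then have [derivative_intros]: "(defect_curve X has_vector_derivative - (X ** D)) (at 0)"
    unfolding defect_curve_def D_def .
  show ?thesis
    unfolding dissolve_eq isqrt_approx_def
    by (auto intro!: derivative_eq_intros simp: matrix_algebra_simps defect_curve_0 D_def[symmetric])
      (simp add: vec_eq_iff)
qed

lemma norm_mult_gram_defect_sq: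
  "(norm (X ** gram_defect X))\<^sup>2 = gram_defect X \<bullet> (gram_defect X + gram_defect X ** gram_defect X)"
  by (simp add: power2_norm_eq_inner inner_matrix_mult_left matrix_mul_assoc gram_eq
      matrix_mult.add_left)

lemma norm_mult_gram_defect_ge:
  "(1 - norm (gram_defect X)) * (norm (gram_defect X))\<^sup>2 \<le> (norm (X ** gram_defect X))\<^sup>2"
proof -
  let ?D = "gram_defect X"
  have "- (?D \<bullet> (?D ** ?D)) \<le> norm ?D * norm (?D ** ?D)"
    using Cauchy_Schwarz_ineq2[of ?D "?D ** ?D"] by simp
  also have "\<dots> \<le> norm ?D * (norm ?D * norm ?D)"
    by (intro mult_left_mono norm_matrix_mult_le) simp
  also have "\<dots> = norm ?D * (norm ?D)\<^sup>2"
    by (simp add: power2_eq_square)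
  finally show ?thesis
    unfolding norm_mult_gram_defect_sq
    by (simp add: inner_add_right left_diff_distrib flip: power2_norm_eq_inner)
qed

lemma norm_mult_gram_defect_ge_half:
  assumes "norm (gram_defect X) \<le> 1 / 2"
  shows "norm (gram_defect X) / 2 \<le> norm (X ** gram_defect X)"
proof (rule power2_le_imp_le)
  have "(norm (gram_defect X) / 2)\<^sup>2 = 1 / 4 * (norm (gram_defect X))\<^sup>2"
    by (simp add: power2_eq_square)
  also have "\<dots> \<le> (1 - norm (gram_defect X)) * (norm (gram_defect X))\<^sup>2"
    using assms by (intro mult_right_mono) simp_all
  also have "\<dots> \<le> (norm (X ** gram_defect X))\<^sup>2"
    by (rule norm_mult_gram_defect_ge)
  finally show "(norm (gram_defect X) / 2)\<^sup>2 \<le> (norm (X ** gram_defect X))\<^sup>2" .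
qed simp

lemma norm_gram_defect_sq_defect_curve_has_real_derivative:
  "((\<lambda>t. (norm (gram_defect (defect_curve X t)))\<^sup>2)
    has_real_derivative - 4 * (norm (X ** gram_defect X))\<^sup>2) (at 0)"
proof -
  let ?D = "gram_defect X"
  have "((\<lambda>t. gram_defect (defect_curve X t) \<bullet> gram_defect (defect_curve X t)) has_vector_derivative
      ?D \<bullet> (- 2) *\<^sub>R (?D + ?D ** ?D) + (- 2) *\<^sub>R (?D + ?D ** ?D) \<bullet> ?D) (at 0)"
    using bounded_bilinear.has_vector_derivative[OF bounded_bilinear_inner
        gram_defect_defect_curve_has_vector_derivative[of X]
        gram_defect_defect_curve_has_vector_derivative[of X]]
    by (simp add: defect_curve_0)
  then show ?thesis
    unfolding has_real_derivative_iff_has_vector_derivative norm_mult_gram_defect_sq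
    unfolding power2_norm_eq_inner by (simp add: inner_commute)
qed

subsection \<open>Exactness of the penalty\<close>

lemma local_minimizer_penalty_first_order:
  fixes X :: "real ^ 'p ^ 'n"
  defines "D \<equiv> gram_defect X"
  assumes "locally_lipschitz f"
    and min: "local_minimizer_on (penalty_fun f \<beta>) UNIV X"
    and M: "\<And>W. W \<in> clarke_subdifferential f (dissolve X) \<Longrightarrow> norm W \<le> M"
  shows "\<beta> * (norm (X ** D))\<^sup>2 \<le> 15 / 8 * M * norm (X ** D ** D ** D)"
proof -
  let ?v = "- (15 / 8) *\<^sub>R (X ** D ** D ** D)"
  let ?\<phi> = "\<lambda>t. dissolve (defect_curve X t)"
  let ?g = "\<lambda>t. \<beta> / 4 * (norm (gram_defect (defect_curve X t)))\<^sup>2"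
  obtain L e where lip: "L-lipschitz_on (ball (?\<phi> 0) e) f" "e > 0"
    using assms(2) unfolding locally_lipschitz_def by blast
  have \<phi>: "(?\<phi> has_vector_derivative ?v) (at_right 0)"
    unfolding D_def
    by (rule has_vector_derivative_at_within[OF dissolve_defect_curve_has_vector_derivative])
  have g: "(?g has_real_derivative \<beta> / 4 * (- 4 * (norm (X ** D))\<^sup>2)) (at_right 0)"
    unfolding D_def
    by (rule has_field_derivative_at_within[OF DERIV_cmult[OF
          norm_gram_defect_sq_defect_curve_has_real_derivative]])
  have "isCont (defect_curve X) 0"
    unfolding defect_curve_def by (intro continuous_intros)
  then have "filterlim (defect_curve X) (nhds X) (at_right 0)"
    by (simp add: isCont_def filterlim_at_split defect_curve_0)
  with min have "\<forall>\<^sub>F t in at_right 0. penalty_fun f \<beta> X \<le> penalty_fun f \<beta> (defect_curve X t)"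
    unfolding local_minimizer_on_UNIV_iff by (rule eventually_compose_filterlim)
  then have min_curve: "\<forall>\<^sub>F t in at_right 0. f (?\<phi> 0) + ?g 0 \<le> f (?\<phi> t) + ?g t"
    by (simp only: penalty_fun_eq defect_curve_0)
  have "clarke_dir_deriv f (?\<phi> 0) ?v \<le> ereal (M * norm ?v)"
    using lip M by (intro clarke_dir_deriv_le_norm) (simp_all only: defect_curve_0)
  then have "0 \<le> M * norm ?v + \<beta> / 4 * (- 4 * (norm (X ** D))\<^sup>2)"
    by (rule clarke_dir_deriv_optimality[OF lip \<phi> g min_curve])
  then show ?thesis
    by simp
qed

lemma local_minimizer_penalty_norm_le:
  fixes X :: "real ^ 'p ^ 'n"
  defines "D \<equiv> gram_defect X"
  assumes "locally_lipschitz f" "local_minimizer_on (penalty_fun f \<beta>) UNIV X" "0 \<le> M"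
    and M: "\<And>W. W \<in> clarke_subdifferential f (dissolve X) \<Longrightarrow> norm W \<le> M"
  shows "\<beta> * norm (X ** D) \<le> 15 / 8 * M * (norm D)\<^sup>2"
proof (cases "X ** D = 0")
  case True
  then show ?thesis
    using \<open>0 \<le> M\<close> by simp
next
  case False
  have "norm (X ** D ** D ** D) \<le> norm (X ** D) * (norm D)\<^sup>2"
    using norm_matrix_mult_le[of "X ** D ** D" D]
      mult_right_mono[OF norm_matrix_mult_le[of "X ** D" D] norm_ge_zero[of D]]
    by (simp add: power2_eq_square mult.assoc)
  then have "15 / 8 * M * norm (X ** D ** D ** D) \<le> 15 / 8 * M * (norm (X ** D) * (norm D)\<^sup>2)"
    using \<open>0 \<le> M\<close> by (intro mult_left_mono) auto
  then have "\<beta> * (norm (X ** D))\<^sup>2 \<le> 15 / 8 * M * (norm (X ** D) * (norm D)\<^sup>2)"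
    using local_minimizer_penalty_first_order[OF assms(2,3) M] unfolding D_def by simp
  then have "\<beta> * norm (X ** D) * norm (X ** D) \<le> 15 / 8 * M * (norm D)\<^sup>2 * norm (X ** D)"
    by (simp add: power2_eq_square mult_ac)
  then show ?thesis
    by (rule mult_right_le_imp_le) (use False in simp)
qed

lemma local_minimizer_penalty_feasible:
  fixes X :: "real ^ 'p ^ 'n"
  assumes "locally_lipschitz f" and min: "local_minimizer_on (penalty_fun f \<beta>) UNIV X"
    and "X \<in> Omega r" and "0 \<le> M" "0 < \<beta>" "0 < r" and r: "r * (2 * \<beta> + 16 * M) < \<beta>"
    and M: "\<And>Y W. Y \<in> Omega 1 \<Longrightarrow> W \<in> clarke_subdifferential f Y \<Longrightarrow> norm W \<le> M"
  shows "X \<in> stiefel"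
proof (rule ccontr)
  let ?D = "gram_defect X"
  assume "X \<notin> stiefel"
  then have "norm ?D > 0"
    by (simp add: stiefel_iff)
  have "norm ?D \<le> r"
    using \<open>X \<in> Omega r\<close> by (simp add: Omega_iff)
  have "0 \<le> r * M" "0 < r * \<beta>"
    using \<open>0 < r\<close> \<open>0 \<le> M\<close> \<open>0 < \<beta>\<close> by simp_all
  moreover have r_expanded: "2 * (r * \<beta>) + 16 * (r * M) < \<beta>"
    using r by (simp add: algebra_simps)
  ultimately have "r * \<beta> < 1 / 2 * \<beta>"
    by linarith
  then have "r < 1 / 2"
    using \<open>0 < \<beta>\<close> by (simp only: mult_less_cancel_right_pos)
  then have "norm ?D / 2 \<le> norm (X ** ?D)"
    using \<open>norm ?D \<le> r\<close> by (intro norm_mult_gram_defect_ge_half) simp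
  then have "\<beta> * (norm ?D / 2) \<le> \<beta> * norm (X ** ?D)"
    using \<open>0 < \<beta>\<close> by simp
  also have "\<dots> \<le> 15 / 8 * M * (norm ?D)\<^sup>2"
  proof (rule local_minimizer_penalty_norm_le[OF assms(1) min \<open>0 \<le> M\<close> M])
    show "dissolve X \<in> Omega 1"
      using norm_gram_defect_dissolve_le_self[of X] \<open>norm ?D \<le> r\<close> \<open>r < 1 / 2\<close>
      by (simp add: Omega_iff)
  qed
  also have "\<dots> \<le> 15 / 8 * M * (r * norm ?D)"
    using \<open>norm ?D \<le> r\<close> \<open>0 \<le> M\<close> unfolding power2_eq_square
    by (intro mult_left_mono mult_right_mono) auto
  finally have "\<beta> / 2 * norm ?D \<le> 15 / 8 * (r * M) * norm ?D"
    by (simp add: mult_ac)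
  then have "\<beta> / 2 \<le> 15 / 8 * (r * M)"
    using \<open>norm ?D > 0\<close> by (rule mult_right_le_imp_le)
  then show False
    using r_expanded \<open>0 \<le> r * M\<close> \<open>0 < r * \<beta>\<close> by linarith
qed

lemma local_minimizer_stiefel_imp_penalty:
  fixes X :: "real ^ 'p ^ 'n"
  assumes "locally_lipschitz f" "\<beta> > 0" and min: "local_minimizer_on f stiefel X"
  shows "local_minimizer_on (penalty_fun f \<beta>) UNIV X"
proof -
  let ?d = "\<lambda>Z. norm (gram_defect Z)"
  let ?K = "2 * (norm (mat 1 :: real ^ 'p ^ 'p) + 1)"
  have X: "X \<in> stiefel"
    using min by (simp add: local_minimizer_on_def)
  obtain L e where "L-lipschitz_on (ball X e) f" "e > 0"
    using assms(1) unfolding locally_lipschitz_def by blast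
  moreover have d: "isCont ?d X" "?d X = 0"
    using X by (auto simp: stiefel_iff intro!: continuous_intros isCont_gram_defect)
  moreover have "\<forall>\<^sub>F Z in nhds X. \<exists>P\<in>stiefel. dist P (dissolve Z) \<le> ?K * ?d Z ^ Suc 2"
  proof -
    have "(?d \<longlongrightarrow> 0) (nhds X)"
      using d by (simp add: isCont_def tendsto_nhds_iff)
    then have "\<forall>\<^sub>F Z in nhds X. ?d Z < 1 / 2"
      by (rule order_tendstoD) simp
    then show ?thesis
      by eventually_elim
        (metis error_bound_stiefel_dissolve less_imp_le numeral_3_eq_3 numeral_2_eq_2)
  qed
  ultimately show ?thesis
    unfolding penalty_fun_eq[abs_def]
    using min X \<open>\<beta> > 0\<close> isCont_dissolve
    by (intro local_minimizer_on_imp_penalized[where S = stiefel and C = ?K])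
      (simp_all add: dissolve_stiefel)
qed

lemma norm_clarke_subdifferential_le_M1:
  assumes "X \<in> Omega 1" "W \<in> clarke_subdifferential f X"
  shows "ennreal (norm W) \<le> M1 f"
  unfolding M1_def using assms by (intro Sup_upper) blast

lemma ennreal_less_divideE:
  assumes "0 \<le> a" "0 < b" "0 < c" "0 \<le> r" "ennreal r < ennreal a / (ennreal b + ennreal c * m)"
  obtains M where "m = ennreal M" "0 \<le> M" "r * (b + c * M) < a"
proof -
  have "m \<noteq> top"
    using assms by (auto simp: ennreal_mult_top)
  then obtain M where M: "0 \<le> M" "m = ennreal M"
    by (metis ennreal_cases infinity_ennreal_def)
  then have "0 < b + c * M"
    using assms by (simp add: add_pos_nonneg)
  moreover have "ennreal a / (ennreal b + ennreal c * m) = ennreal (a / (b + c * M))"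
    using M assms \<open>0 < b + c * M\<close>
    by (simp add: divide_ennreal[symmetric] ennreal_plus ennreal_mult)
  ultimately have "r * (b + c * M) < a"
    using assms by (simp add: ennreal_less_iff pos_less_divide_eq)
  with M show thesis
    by (intro that)
qed

theorem theorem3p14:
  fixes f :: "real ^ 'p ^ 'n \<Rightarrow> real" and \<beta> r :: real
  assumes "locally_lipschitz f"
    and "\<beta> > 0"
    and "0 < r" and "ennreal r < ennreal \<beta> / (2 * ennreal \<beta> + 16 * M1 f)"
  shows "(\<forall>X\<in>Omega r. local_minimizer_on (penalty_fun f \<beta>) UNIV X \<longrightarrow>
            local_minimizer_on f stiefel X) \<and>
         (\<forall>X. local_minimizer_on f stiefel X \<longrightarrow>
            local_minimizer_on (penalty_fun f \<beta>) UNIV X)"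
proof (intro conjI ballI allI impI)
  obtain M where "M1 f = ennreal M" "0 \<le> M" and r: "r * (2 * \<beta> + 16 * M) < \<beta>"
    using ennreal_less_divideE[of \<beta> "2 * \<beta>" 16 r "M1 f"] assms(2-4) by (auto simp: ennreal_mult)
  then have bound: "norm W \<le> M" if "Y \<in> Omega 1" "W \<in> clarke_subdifferential f Y" for Y W
    using norm_clarke_subdifferential_le_M1[OF that] by simp
  fix X :: "real ^ 'p ^ 'n"
  assume X: "X \<in> Omega r" and min: "local_minimizer_on (penalty_fun f \<beta>) UNIV X"
  from local_minimizer_penalty_feasible[OF assms(1) min X \<open>0 \<le> M\<close> assms(2,3) r bound]
  have "X \<in> stiefel" .
  with min show "local_minimizer_on f stiefel X"
    by (rule local_minimizer_on_subset) (auto simp: penalty_fun_stiefel)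
next
  fix X :: "real ^ 'p ^ 'n"
  assume "local_minimizer_on f stiefel X"
  then show "local_minimizer_on (penalty_fun f \<beta>) UNIV X"
    using local_minimizer_stiefel_imp_penalty assms(1,2) by blast
qed

end
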